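(* Let $X=[n]$ be the disjoint union of sets $X_1$ and $X_2$. Let $A_1,\dots,A_m,B_1,\dots,B_m\subseteq X$ be such that $\mathcal{P}=\{(A_i,B_i)\mid i\in[m]\}$ is a Bollobás system. Then $$\sum_{i=1}^m \left(\binom{|A_i\cap X_1|+|B_i\cap X_1|}{|A_i\cap X_1|}\binom{|A_i\cap X_2|+|B_i\cap X_2|}{|A_i\cap X_2|}\right)^{-1} \le 1+\left\lfloor \frac{n}{2}\right\rfloor.$$
   Context: A family of pairs of sets $\mathcal{P}=\{(A_i,B_i)\mid i\in[m]\}$ is called a Bollobás system if for all $i,j\in[m]$: $A_i\cap B_j=\emptyset$ if and only if $i=j$. Here $[n]=\{1,\dots,n\}$. *)

theory Defs
  imports Complex_Main
begin

text \<open>The family is indexed by \<open>{1..m}\<close>; only the values of \<open>A\<close> and \<open>B\<close> there matter.\<close>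

definition bollobas_system :: "nat \<Rightarrow> (nat \<Rightarrow> 'a set) \<Rightarrow> (nat \<Rightarrow> 'a set) \<Rightarrow> bool" where
  "bollobas_system m A B \<longleftrightarrow>
     (\<forall>i\<in>{1..m}. \<forall>j\<in>{1..m}. A i \<inter> B j = {} \<longleftrightarrow> i = j)"

end

theory Submission
  imports Defs "HOL-Combinatorics.Permutations"
begin

text \<open>
  Permute \<open>X1\<close> and \<open>X2\<close> independently and uniformly at random. The summand for \<open>i\<close> is the
  probability that, in both parts, all elements of \<open>A i\<close> come before all elements of \<open>B i\<close>.
  If this happens for \<open>i\<close>, it yields a pair of cut points separating \<open>A i\<close> from \<open>B i\<close>; since
  \<open>A i \<inter> B j\<close> and \<open>A j \<inter> B i\<close> are both nonempty for \<open>i \<noteq> j\<close>, the pairs of cut points form a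
  strict antichain in \<open>{0..card X1} \<times> {0..card X2}\<close>. So at most \<open>1 + min (card X1) (card X2)\<close>
  of the events occur simultaneously, and this bounds their expected number.
\<close>

definition precedes :: "('a \<Rightarrow> 'b::ord) \<Rightarrow> 'a set \<Rightarrow> 'a set \<Rightarrow> bool" where
  "precedes p A B \<longleftrightarrow> (\<forall>a\<in>A. \<forall>b\<in>B. p a < p b)"

text \<open>A permutation \<open>p\<close> of \<open>S\<close> is read as an ordering:
  \<open>p x\<close> is the position of \<open>x\<close>, and the elements of \<open>S\<close>
  themselves serve as positions, hence the linear order on \<open>'a\<close>.\<close>

definition preceding_perms :: "'a::linorder set \<Rightarrow> 'a set \<Rightarrow> 'a set \<Rightarrow> ('a \<Rightarrow> 'a) set" where
  "preceding_perms S A B = {p. p permutes S \<and> precedes p A B}"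

lemma finite_preceding_perms: "finite S \<Longrightarrow> finite (preceding_perms S A B)"
  unfolding preceding_perms_def
  by (rule finite_subset[OF _ finite_permutations[of S]]) auto

text \<open>Take the \<open>k\<close> elements with the smallest values: repeatedly adding a
  minimiser of the rest works, and injectivity makes each minimum strict.\<close>

lemma ex_initial_subset:
  fixes p :: "'a \<Rightarrow> 'b::linorder"
  assumes "finite C" "inj_on p C" "k \<le> card C"
  shows "\<exists>A\<subseteq>C. card A = k \<and> precedes p A (C - A)"
  using assms(3)
proof (induction k)
  case 0
  show ?case by (rule exI[of _ "{}"]) (simp add: precedes_def)
next
  case (Suc k)
  then obtain A where A: "A \<subseteq> C" "card A = k" "precedes p A (C - A)" by auto
  have finA: "finite A" using A(1) assms(1) finite_subset by blast
  have "C - A \<noteq> {}"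
    using A(1,2) Suc.prems by auto
  then obtain c where c: "c \<in> C - A" "\<And>y. y \<in> C - A \<Longrightarrow> p c \<le> p y"
    using arg_min_if_finite(1)[of "C - A" p] arg_min_least[of "C - A" _ p] assms(1) by blast
  have "p c < p y" if "y \<in> C - insert c A" for y
    using c(2)[of y] that c(1) assms(2) by (force simp: inj_on_def order_less_le)
  then have "precedes p (insert c A) (C - insert c A)"
    using A(3) by (auto simp: precedes_def)
  moreover have "card (insert c A) = Suc k" using c(1) finA A(2) by simp
  ultimately show ?case using A(1) c(1) by (intro exI[of _ "insert c A"]) auto
qed

text \<open>Glue a bijection from \<open>A\<close> to \<open>A'\<close> with one between their
  complements in \<open>C\<close>, and fix everything outside \<open>C\<close>.\<close>

lemma ex_permutes_image_subset:
  assumes "finite C" "A \<subseteq> C" "A' \<subseteq> C" "card A = card A'"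
  obtains s where "s permutes C" "s ` A = A'" "s ` (C - A) = C - A'"
proof -
  have fin: "finite A" "finite A'" using assms finite_subset by blast+
  obtain g where g: "bij_betw g A A'"
    using finite_same_card_bij[OF fin assms(4)] by blast
  have "card (C - A) = card (C - A')"
    using assms fin by (simp add: card_Diff_subset)
  then obtain h where h: "bij_betw h (C - A) (C - A')"
    using finite_same_card_bij[of "C - A" "C - A'"] assms(1) by blast
  define s where "s x = (if x \<in> A then g x else if x \<in> C then h x else x)" for x
  have sA: "bij_betw s A A'"
    using g by (rule bij_betw_cong[THEN iffD1, rotated]) (simp add: s_def)
  have sD: "bij_betw s (C - A) (C - A')"
    using h by (rule bij_betw_cong[THEN iffD1, rotated]) (simp add: s_def)
  have "bij_betw s (A \<union> (C - A)) (A' \<union> (C - A'))"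
    by (rule bij_betw_combine[OF sA sD]) auto
  then have "bij_betw s C C" using assms(2,3) by (simp add: Un_absorb1)
  then have "s permutes C"
    by (rule bij_imp_permutes) (use assms(2) in \<open>auto simp: s_def\<close>)
  with sA sD show ?thesis using that by (auto simp: bij_betw_def)
qed

text \<open>Relabelling by a permutation \<open>s\<close> that carries \<open>A\<close> to
  \<open>A'\<close> and preserves \<open>C\<close> turns orderings with \<open>A'\<close> first into
  orderings with \<open>A\<close> first, injectively.\<close>

lemma card_preceding_perms_mono:
  assumes "finite S" "C \<subseteq> S" "A \<subseteq> C" "A' \<subseteq> C" "card A = card A'"
  shows "card (preceding_perms S A' (C - A')) \<le> card (preceding_perms S A (C - A))"
proof -
  obtain s where s: "s permutes C" "s ` A = A'" "s ` (C - A) = C - A'"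
    using ex_permutes_image_subset assms finite_subset by metis
  have sS: "s permutes S" using s(1) assms(2) by (rule permutes_subset)
  have "inj_on (\<lambda>p. p \<circ> s) (preceding_perms S A' (C - A'))"
    by (intro inj_onI) (metis comp_id o_assoc permutes_inv_o(1)[OF sS])
  moreover have "(\<lambda>p. p \<circ> s) ` preceding_perms S A' (C - A') \<subseteq> preceding_perms S A (C - A)"
    unfolding s(3)[symmetric] unfolding s(2)[symmetric] preceding_perms_def precedes_def
    using permutes_compose[OF sS] by auto
  ultimately show ?thesis
    using finite_preceding_perms[OF assms(1)] by (rule card_inj_on_le)
qed

text \<open>Only the inequality is needed: every permutation puts some \<open>card A\<close>-subset of \<open>A \<union> B\<close>
  first, and by symmetry all these subsets are equally likely.\<close>

lemma fact_le_choose_mult_card_preceding_perms: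
  assumes "finite S" "A \<subseteq> S" "B \<subseteq> S" "A \<inter> B = {}"
  shows "fact (card S) \<le> ((card A + card B) choose card A) * card (preceding_perms S A B)"
proof -
  define C where "C = A \<union> B"
  define F where "F = {A'. A' \<subseteq> C \<and> card A' = card A}"
  have C: "C \<subseteq> S" "finite C" "A \<subseteq> C" "C - A = B"
    using assms finite_subset[of C S] by (auto simp: C_def)
  have cardC: "card C = card A + card B"
    using assms finite_subset[of _ S] by (simp add: C_def card_Un_disjoint)
  have finF: "finite F" using C(2) by (simp add: F_def)
  have "{p. p permutes S} \<subseteq> (\<Union>A'\<in>F. preceding_perms S A' (C - A'))"
  proof
    fix p assume "p \<in> {p. p permutes S}"
    then have p: "p permutes S" by simp
    have "\<exists>A'\<subseteq>C. card A' = card A \<and> precedes p A' (C - A')"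
      by (rule ex_initial_subset[OF C(2)])
        (use permutes_inj_on[OF p] cardC in auto)
    then show "p \<in> (\<Union>A'\<in>F. preceding_perms S A' (C - A'))"
      using p by (auto simp: F_def preceding_perms_def)
  qed
  then have "fact (card S) \<le> card (\<Union>A'\<in>F. preceding_perms S A' (C - A'))"
    using card_mono[of "\<Union>A'\<in>F. preceding_perms S A' (C - A')" "{p. p permutes S}"]
      finF finite_preceding_perms[OF assms(1)] card_permutations[OF refl assms(1)]
    by simp
  also have "\<dots> \<le> (\<Sum>A'\<in>F. card (preceding_perms S A' (C - A')))"
    by (rule card_UN_le[OF finF])
  also have "\<dots> \<le> (\<Sum>A'\<in>F. card (preceding_perms S A (C - A)))"
    by (rule sum_mono, rule card_preceding_perms_mono) (use assms(1) C in \<open>auto simp: F_def\<close>)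
  also have "\<dots> = ((card A + card B) choose card A) * card (preceding_perms S A B)"
    using n_subsets[OF C(2), of "card A"] C(4) cardC by (simp add: F_def)
  finally show ?thesis .
qed

text \<open>The right-hand side is the probability that a uniformly random ordering of
  \<open>S\<close> places \<open>A\<close> before \<open>B\<close>.\<close>

lemma inverse_choose_le_preceding_fraction:
  assumes "finite S" "A \<subseteq> S" "B \<subseteq> S" "A \<inter> B = {}"
  shows "inverse (real ((card A + card B) choose card A))
           \<le> real (card (preceding_perms S A B)) / fact (card S)"
proof -
  let ?c = "(card A + card B) choose card A"
  have "?c > 0" by simp
  moreover have "real (fact (card S)) \<le> real (?c * card (preceding_perms S A B))"
    using fact_le_choose_mult_card_preceding_perms[OF assms] of_nat_le_iff by blast
  ultimately show ?thesis by (simp add: field_simps)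
qed

text \<open>The first cut point \<open>cut i\<close> already determines \<open>i\<close>.\<close>

lemma card_cross_intersecting_le:
  fixes p q :: "'a \<Rightarrow> nat"
  assumes "finite X1"
    and "\<And>i. i \<in> I \<Longrightarrow> A i \<subseteq> X1 \<union> X2"
    and "\<And>i j. i \<in> I \<Longrightarrow> j \<in> I \<Longrightarrow> i \<noteq> j \<Longrightarrow> A i \<inter> B j \<noteq> {}"
    and "\<And>i. i \<in> I \<Longrightarrow> precedes p (A i \<inter> X1) (B i \<inter> X1)"
    and "\<And>i. i \<in> I \<Longrightarrow> precedes q (A i \<inter> X2) (B i \<inter> X2)"
  shows "card I \<le> 1 + card X1"
proof -
  \<comment> \<open>One past the last position of \<open>A i\<close> in \<open>X1\<close>; the shift
    by \<open>Suc\<close> reserves 0 for the case that \<open>A i\<close> misses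
    \<open>X1\<close>.\<close>
  define cut where "cut i = Max (insert 0 ((Suc \<circ> p) ` (A i \<inter> X1)))" for i
  \<comment> \<open>A common element of \<open>A i\<close> and \<open>B j\<close> in
    \<open>X1\<close> would lie below \<open>cut i\<close>, and also at or above
    \<open>cut j\<close> since \<open>B j\<close> follows \<open>A j\<close> there. Equal cuts thus
    force it into \<open>X2\<close>.\<close>
  have meet_X2: "A i \<inter> B j \<inter> X2 \<noteq> {}"
    if ij: "i \<in> I" "j \<in> I" "i \<noteq> j" and eq: "cut i = cut j" for i j
  proof -
    obtain x where x: "x \<in> A i" "x \<in> B j" using assms(3)[OF ij] by blast
    have "x \<notin> X1"
    proof
      assume "x \<in> X1"
      then have "Suc (p x) \<le> cut i"
        using x(1) assms(1) by (auto simp: cut_def intro!: Max_ge)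
      moreover have "cut j \<le> p x"
        using x(2) \<open>x \<in> X1\<close> assms(1) assms(4)[OF ij(2)]
        by (auto simp: cut_def precedes_def Suc_le_eq)
      ultimately show False using eq by simp
    qed
    then show ?thesis using x assms(2)[OF ij(1)] by blast
  qed
  have "inj_on cut I"
  proof (rule inj_onI, rule ccontr)
    fix i j assume ij: "i \<in> I" "j \<in> I" "cut i = cut j" "i \<noteq> j"
    obtain x where x: "x \<in> A i" "x \<in> B j" "x \<in> X2" using meet_X2[of i j] ij by auto
    obtain y where y: "y \<in> A j" "y \<in> B i" "y \<in> X2" using meet_X2[of j i] ij by auto
    \<comment> \<open>\<open>x\<close> in \<open>A i\<close> comes before \<open>y\<close> in
      \<open>B i\<close>, while \<open>y\<close> in \<open>A j\<close> comes before \<open>x\<close>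
      in \<open>B j\<close>.\<close>
    have "q x < q y" using assms(5)[OF ij(1)] x y by (auto simp: precedes_def)
    moreover have "q y < q x" using assms(5)[OF ij(2)] x y by (auto simp: precedes_def)
    ultimately show False by simp
  qed
  \<comment> \<open>A maximum is attained, so apart from 0 only successors of positions of
    \<open>X1\<close> occur.\<close>
  moreover have "cut ` I \<subseteq> insert 0 ((Suc \<circ> p) ` X1)"
  proof
    fix t assume "t \<in> cut ` I"
    then obtain i where "t = cut i" by blast
    moreover have "cut i \<in> insert 0 ((Suc \<circ> p) ` (A i \<inter> X1))"
      unfolding cut_def by (rule Max_in) (use assms(1) in auto)
    ultimately show "t \<in> insert 0 ((Suc \<circ> p) ` X1)" by auto
  qed
  ultimately have "card I \<le> card (insert 0 ((Suc \<circ> p) ` X1))"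
    by (rule card_inj_on_le) (use assms(1) in simp)
  also have "\<dots> \<le> 1 + card X1"
    using card_image_le[OF assms(1), of "Suc \<circ> p"] assms(1) by (simp add: card_insert_if)
  finally show ?thesis .
qed

text \<open>The expectation argument as a double count of triples \<open>(i, p, q)\<close> in which
  the orderings \<open>p\<close> of \<open>X1\<close> and \<open>q\<close> of \<open>X2\<close> both
  place \<open>A i\<close> before \<open>B i\<close>.\<close>

lemma sum_inverse_choose_le:
  fixes X1 X2 :: "nat set" and A B :: "'i \<Rightarrow> nat set"
  assumes "finite I" "finite X1" "finite X2"
    and sub: "\<And>i. i \<in> I \<Longrightarrow> A i \<subseteq> X1 \<union> X2"
    and cross: "\<And>i j. i \<in> I \<Longrightarrow> j \<in> I \<Longrightarrow> A i \<inter> B j = {} \<longleftrightarrow> i = j"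
  shows "(\<Sum>i\<in>I. inverse (
            real ((card (A i \<inter> X1) + card (B i \<inter> X1)) choose card (A i \<inter> X1)) *
            real ((card (A i \<inter> X2) + card (B i \<inter> X2)) choose card (A i \<inter> X2))))
         \<le> 1 + real (min (card X1) (card X2))"
proof -
  define P where "P X i = preceding_perms X (A i \<inter> X) (B i \<inter> X)" for X i
  define M where "M = 1 + min (card X1) (card X2)"
  let ?R = "{p. p permutes X1} \<times> {q. q permutes X2}"
  let ?f = "fact (card X1) * fact (card X2) :: real"
  have finR: "finite ?R" using assms(2,3) by (simp add: finite_permutations)
  have cardR: "real (card ?R) = ?f"
    by (simp add: card_permutations[OF refl] assms(2,3) card_cartesian_product)
  have fraction: "inverse (real ((card (A i \<inter> X) + card (B i \<inter> X)) choose card (A i \<inter> X)))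
      \<le> real (card (P X i)) / fact (card X)" if "i \<in> I" "finite X" for i X
    unfolding P_def using that cross[of i i]
    by (intro inverse_choose_le_preceding_fraction) auto
  \<comment> \<open>The cut argument is symmetric in the two parts, so applying it once with each
    part in the first role gives the minimum.\<close>
  have bound: "card {i \<in> I. r \<in> P X1 i \<times> P X2 i} \<le> M" for r
  proof -
    obtain p q where r: "r = (p, q)" by fastforce
    let ?J = "{i \<in> I. r \<in> P X1 i \<times> P X2 i}"
    have "card ?J \<le> 1 + card X1"
      by (rule card_cross_intersecting_le[where A = A and B = B and p = p and q = q and ?X2.0 = X2])
        (use assms r in \<open>auto simp: P_def preceding_perms_def\<close>)
    moreover have "card ?J \<le> 1 + card X2"
      by (rule card_cross_intersecting_le[where A = A and B = B and p = q and q = p and ?X2.0 = X1])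
        (use assms r in \<open>auto simp: P_def preceding_perms_def\<close>)
    ultimately show ?thesis by (simp add: M_def)
  qed
  have "(\<Sum>i\<in>I. card (P X1 i \<times> P X2 i)) = (\<Sum>i\<in>I. card {r \<in> ?R. r \<in> P X1 i \<times> P X2 i})"
    by (intro sum.cong refl arg_cong[where f = card]) (auto simp: P_def preceding_perms_def)
  also have "\<dots> = (\<Sum>r\<in>?R. card {i \<in> I. r \<in> P X1 i \<times> P X2 i})"
    using sum.swap_restrict[OF assms(1) finR, of "\<lambda>_ _. 1::nat" "\<lambda>i r. r \<in> P X1 i \<times> P X2 i"]
    by simp
  also have "\<dots> \<le> (\<Sum>r\<in>?R. M)"
    by (intro sum_mono bound)
  finally have "(\<Sum>i\<in>I. card (P X1 i \<times> P X2 i)) \<le> card ?R * M" by simp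
  then have count: "real (\<Sum>i\<in>I. card (P X1 i \<times> P X2 i)) \<le> ?f * real M"
    unfolding cardR[symmetric] of_nat_mult[symmetric] by (rule of_nat_mono)
  have "(\<Sum>i\<in>I. inverse (
            real ((card (A i \<inter> X1) + card (B i \<inter> X1)) choose card (A i \<inter> X1)) *
            real ((card (A i \<inter> X2) + card (B i \<inter> X2)) choose card (A i \<inter> X2))))
      \<le> (\<Sum>i\<in>I. real (card (P X1 i)) / fact (card X1) * (real (card (P X2 i)) / fact (card X2)))"
    unfolding inverse_mult_distrib
    by (intro sum_mono mult_mono fraction) (use assms(2,3) in auto)
  also have "\<dots> = real (\<Sum>i\<in>I. card (P X1 i \<times> P X2 i)) / ?f"
    by (simp add: card_cartesian_product sum_divide_distrib)
  also have "\<dots> \<le> real M"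
    using count by (simp add: divide_le_eq mult.commute)
  finally show ?thesis by (simp add: M_def)
qed

theorem theorem1p8:
  fixes n m :: nat and X X1 X2 :: "nat set" and A B :: "nat \<Rightarrow> nat set"
  assumes "X = {1..n}"
    and "X = X1 \<union> X2" and "X1 \<inter> X2 = {}"
    and "\<And>i. i \<in> {1..m} \<Longrightarrow> A i \<subseteq> X"
    and "\<And>i. i \<in> {1..m} \<Longrightarrow> B i \<subseteq> X"
    and "bollobas_system m A B"
  shows "(\<Sum>i=1..m. inverse (
            real ((card (A i \<inter> X1) + card (B i \<inter> X1)) choose card (A i \<inter> X1)) *
            real ((card (A i \<inter> X2) + card (B i \<inter> X2)) choose card (A i \<inter> X2))))
         \<le> 1 + real_of_int \<lfloor>real n / 2\<rfloor>"
proof -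
  have fin: "finite X1" "finite X2"
    using assms(1,2) by (metis finite_Un finite_atLeastAtMost)+
  have "card X1 + card X2 = n"
    using card_Un_disjoint[OF fin assms(3)] assms(1,2) by simp
  \<comment> \<open>The bound in terms of the part sizes is largest for balanced parts, which yields
    the floor.\<close>
  then have "min (card X1) (card X2) \<le> n div 2" by linarith
  moreover have "\<lfloor>real n / 2\<rfloor> = int (n div 2)"
    using floor_divide_of_nat_eq[of n 2] by simp
  ultimately have "real (min (card X1) (card X2)) \<le> real_of_int \<lfloor>real n / 2\<rfloor>"
    by (metis of_int_of_nat_eq of_nat_le_iff)
  moreover have "(\<Sum>i=1..m. inverse (
            real ((card (A i \<inter> X1) + card (B i \<inter> X1)) choose card (A i \<inter> X1)) *
            real ((card (A i \<inter> X2) + card (B i \<inter> X2)) choose card (A i \<inter> X2))))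
         \<le> 1 + real (min (card X1) (card X2))"
    by (rule sum_inverse_choose_le)
      (use fin assms(2,4,6) in \<open>auto simp: bollobas_system_def\<close>)
  ultimately show ?thesis by linarith
qed

end
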